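(* Let $\mathbb{X}$ be a Banach space, $p\in[1,\infty)$, let $\omega\ge1$ be an integer and let $u\in SAP_\omega(\mathbb{R}^+,\mathbb{X})$. Then the function $t\mapsto u([t])$ is $S$-asymptotically $\omega$-periodic in the Stepanov sense (with exponent $p$) but is not $S$-asymptotically $\omega$-periodic.
   Context: $\mathbb{R}^+=[0,\infty)$ and $[\cdot]$ is the largest integer (floor) function. A function $g:\mathbb{R}^+\to\mathbb{X}$ is $S$-asymptotically $\omega$-periodic if it is bounded and continuous and $\lim_{t\to\infty}(g(t+\omega)-g(t))=0$; the set of such functions is $SAP_\omega(\mathbb{R}^+,\mathbb{X})$. $BS^p(\mathbb{R}^+,\mathbb{X})$: the measurable functions $g:\mathbb{R}^+\to\mathbb{X}$ with $\sup_{t\ge0}\big(\int_t^{t+1}\|g(\tau)\|^pd\tau\big)^{1/p}<\infty$. A function $g\in BS^p(\mathbb{R}^+,\mathbb{X})$ is $S$-asymptotically $\omega$-periodic in the Stepanov sense if $\lim_{t\to\infty}\int_t^{t+1}\|g(s+\omega)-g(s)\|^pds=0$.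
   Formalization: The claim that u([t]) is not S-asymptotically ω-periodic is made only for u not constant on the nonnegative integers; otherwise (e.g. u = 0) u([t]) is constant on [0,∞), hence S-asymptotically ω-periodic, and the claim as stated fails. *)

theory Defs
  imports "HOL-Analysis.Analysis"
begin

text \<open>
  Functions on \<open>[0,\<infinity>)\<close> are represented by total functions on the reals of which only
  the values on \<open>{0..}\<close> are used.
\<close>

definition SAP :: "real \<Rightarrow> (real \<Rightarrow> 'a::real_normed_vector) set" where
  "SAP \<omega> = {g. bounded (g ` {0..}) \<and> continuous_on {0..} g \<and>
               ((\<lambda>t. g (t + \<omega>) - g t) \<longlongrightarrow> 0) at_top}"

text \<open>
  Measurability of a Banach-space valued function is strong (Bochner) measurability, as the
  space need not be separable. It implies Borel measurability with respect to the
  Lebesgue sigma-algebra and agrees with it when the space is separable.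
\<close>

definition strongly_measurable :: "'b measure \<Rightarrow> ('b \<Rightarrow> 'a::topological_space) \<Rightarrow> bool" where
  "strongly_measurable M g \<longleftrightarrow>
     (\<exists>s :: nat \<Rightarrow> 'b \<Rightarrow> 'a. (\<forall>i. simple_function M (s i)) \<and>
        (AE x in M. (\<lambda>i. s i x) \<longlonglongrightarrow> g x))"

text \<open>
  Integrability on every \<open>[t,t+1]\<close> is demanded explicitly, since the integral of a
  non-integrable function is 0 by convention.
\<close>

definition BS :: "real \<Rightarrow> (real \<Rightarrow> 'a::real_normed_vector) set" where
  "BS p = {g. strongly_measurable (lebesgue_on {0..}) g \<and>
      (\<forall>t\<ge>0. set_integrable lebesgue {t..t+1} (\<lambda>\<tau>. norm (g \<tau>) powr p)) \<and>
      bdd_above ((\<lambda>t. (LINT \<tau>:{t..t+1}|lebesgue. norm (g \<tau>) powr p) powr (1 / p)) ` {0..})}"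

definition Stepanov_SAP :: "real \<Rightarrow> real \<Rightarrow> (real \<Rightarrow> 'a::real_normed_vector) set" where
  "Stepanov_SAP p \<omega> = {g \<in> BS p.
      ((\<lambda>t. LINT s:{t..t+1}|lebesgue. norm (g (s + \<omega>) - g s) powr p) \<longlongrightarrow> 0) at_top}"

text \<open>
  If \<open>u\<close> is constant on the nonnegative integers (for instance \<open>u = 0\<close>), then
  \<open>t \<mapsto> u \<lfloor>t\<rfloor>\<close> is constant on \<open>[0,\<infinity>)\<close> and hence does belong to \<open>SAP\<close>; a claim that it
  does not belong to \<open>SAP\<close> has to exclude exactly this case.
\<close>

lemma floor_step_in_SAP:
  fixes u :: "real \<Rightarrow> 'a::real_normed_vector"
  assumes "\<And>m n :: nat. u (real m) = u (real n)" and "\<omega> \<ge> 0"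
  shows "(\<lambda>t. u (of_int \<lfloor>t\<rfloor>)) \<in> SAP \<omega>"
proof -
  have c: "u (of_int \<lfloor>t\<rfloor>) = u 0" if "t \<ge> 0" for t :: real
    using assms(1)[of "nat \<lfloor>t\<rfloor>" 0] that by simp
  have "bounded ((\<lambda>t::real. u (of_int \<lfloor>t\<rfloor>)) ` {0..})"
    by (rule bounded_subset[of "{u 0}"]) (auto simp: c)
  moreover have "continuous_on {0..} (\<lambda>t::real. u (of_int \<lfloor>t\<rfloor>))"
    by (subst continuous_on_cong[OF refl, of _ _ "\<lambda>_. u 0"]) (auto simp: c)
  moreover have "((\<lambda>t::real. u (of_int \<lfloor>t + \<omega>\<rfloor>) - u (of_int \<lfloor>t\<rfloor>)) \<longlongrightarrow> 0) at_top"
    by (rule tendsto_eventually, rule eventually_at_top_linorderI[of 0])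
       (use assms(2) in \<open>simp add: c del: floor_add\<close>)
  ultimately show ?thesis by (simp add: SAP_def)
qed

end

theory Submission
  imports Defs
begin

text \<open>
  On \<open>[t,t+1]\<close> the Stepanov integrand depends on \<open>\<lfloor>s\<rfloor>\<close> only, so a bound over the integers
  \<open>n \<ge> \<lfloor>t\<rfloor>\<close> bounds its integral; boundedness of \<open>u\<close> and \<open>u(n+\<omega>) - u(n) \<longrightarrow> 0\<close> then give the
  Stepanov property. If \<open>t \<mapsto> u(\<lfloor>t\<rfloor>)\<close> is continuous at \<open>n+1\<close> from the left, then
  \<open>u(n) = u(n+1)\<close>, so continuity forces \<open>u\<close> to be constant on the nonnegative integers.
\<close>

text \<open>On \<open>{0..}\<close> the truncations \<open>min \<lfloor>x\<rfloor> (int i)\<close>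
  take finitely many values, and at each point they equal \<open>\<lfloor>x\<rfloor>\<close> for all
  large \<open>i\<close>. Composition with an arbitrary \<open>h\<close> keeps both
  properties.\<close>

lemma strongly_measurable_floor:
  fixes h :: "int \<Rightarrow> 'a::topological_space"
  shows "strongly_measurable (lebesgue_on {0..}) (\<lambda>t::real. h \<lfloor>t\<rfloor>)"
  unfolding strongly_measurable_def
proof (intro exI conjI allI)
  fix i :: nat
  have "simple_function (lebesgue_on {0..}) (\<lambda>x::real. min \<lfloor>x\<rfloor> (int i))"
    unfolding simple_function_eq_measurable
  proof
    have "(\<lambda>x::real. min \<lfloor>x\<rfloor> (int i)) ` space (lebesgue_on {0..}) \<subseteq> {0..int i}"
      by auto
    then show "finite ((\<lambda>x::real. min \<lfloor>x\<rfloor> (int i)) ` space (lebesgue_on {0..}))"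
      by (rule finite_subset) simp
    have "(\<lambda>x::real. min \<lfloor>x\<rfloor> (int i)) \<in> borel \<rightarrow>\<^sub>M count_space UNIV"
      by measurable
    then show "(\<lambda>x::real. min \<lfloor>x\<rfloor> (int i)) \<in> lebesgue_on {0..} \<rightarrow>\<^sub>M count_space UNIV"
      by (intro measurable_restrict_space1 measurable_completion) simp
  qed
  from simple_function_compose[OF this, of h]
  show "simple_function (lebesgue_on {0..}) (\<lambda>x::real. h (min \<lfloor>x\<rfloor> (int i)))"
    by (simp add: o_def)
next
  have "(\<lambda>i. h (min \<lfloor>x\<rfloor> (int i))) \<longlonglongrightarrow> h \<lfloor>x\<rfloor>" for x :: real
    by (rule tendsto_eventually, rule eventually_sequentiallyI[of "nat \<lfloor>x\<rfloor>"]) (simp add: min_def nat_le_iff)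
  then show "AE x::real in lebesgue_on {0..}. (\<lambda>i. h (min \<lfloor>x\<rfloor> (int i))) \<longlonglongrightarrow> h \<lfloor>x\<rfloor>"
    by simp
qed

text \<open>The interval has length 1, so a pointwise bound is also a bound for the integral. A
  bound on a tail of the integers is what both uses supply: boundedness on the nonnegative integers,
  and smallness far out.\<close>

lemma
  fixes h :: "int \<Rightarrow> real" and t C :: real
  assumes bound: "\<And>n. n \<ge> \<lfloor>t\<rfloor> \<Longrightarrow> \<bar>h n\<bar> \<le> C"
  shows set_integrable_floor: "set_integrable lebesgue {t..t+1} (\<lambda>s. h \<lfloor>s\<rfloor>)"
    and abs_set_integral_floor_le: "\<bar>LINT s:{t..t+1}|lebesgue. h \<lfloor>s\<rfloor>\<bar> \<le> C"
proof -
  have le: "\<bar>h \<lfloor>s\<rfloor>\<bar> \<le> C" if "s \<in> {t..t+1}" for s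
    using that by (intro bound floor_mono) simp
  have const: "set_integrable lebesgue {t..t+1} (\<lambda>s. C)"
    by (simp add: set_integrable_def)
  have "(\<lambda>s::real. h \<lfloor>s\<rfloor>) \<in> borel_measurable borel"
    by measurable
  then have meas: "(\<lambda>s::real. h \<lfloor>s\<rfloor>) \<in> borel_measurable lebesgue"
    by (simp add: measurable_completion)
  show int: "set_integrable lebesgue {t..t+1} (\<lambda>s. h \<lfloor>s\<rfloor>)"
    \<comment> \<open>Domination is by \<open>norm C\<close>, hence the extra step
      \<open>C \<le> \<bar>C\<bar>\<close>.\<close>
    by (rule set_integrable_bound[OF const])
      (use le meas in \<open>auto simp: set_borel_measurable_def abs_le_iff
        intro!: AE_I2 borel_measurable_times borel_measurable_indicator order_trans[OF _ abs_ge_self]\<close>)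
  have "\<bar>LINT s:{t..t+1}|lebesgue. h \<lfloor>s\<rfloor>\<bar> \<le> (LINT s:{t..t+1}|lebesgue. \<bar>h \<lfloor>s\<rfloor>\<bar>)"
    using set_integral_norm_bound[OF int] by simp
  also have "\<dots> \<le> (LINT s:{t..t+1}|lebesgue. C)"
    using set_integrable_abs[OF int] const le by (intro set_integral_mono) auto
  also have "\<dots> = C"
    by (simp add: set_lebesgue_integral_def)
  finally show "\<bar>LINT s:{t..t+1}|lebesgue. h \<lfloor>s\<rfloor>\<bar> \<le> C" .
qed

lemma tendsto_set_integral_floor:
  fixes h :: "int \<Rightarrow> real"
  assumes "(h \<longlongrightarrow> 0) at_top"
  shows "((\<lambda>t::real. LINT s:{t..t+1}|lebesgue. h \<lfloor>s\<rfloor>) \<longlongrightarrow> 0) at_top"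
proof (rule tendstoI)
  fix e :: real
  assume "e > 0"
  \<comment> \<open>Half of \<open>e\<close>, since the bound on the integral is not strict.\<close>
  then have "\<forall>\<^sub>F n in at_top. \<bar>h n\<bar> < e / 2"
    using tendstoD[OF assms, of "e / 2"] by (simp add: dist_real_def)
  then obtain N where N: "\<And>n. n \<ge> N \<Longrightarrow> \<bar>h n\<bar> < e / 2"
    by (auto simp: eventually_at_top_linorder)
  have "dist (LINT s:{t..t+1}|lebesgue. h \<lfloor>s\<rfloor>) 0 < e" if "t \<ge> of_int N" for t :: real
  proof -
    have "\<bar>h n\<bar> \<le> e / 2" if "n \<ge> \<lfloor>t\<rfloor>" for n
      using N[of n] that \<open>t \<ge> of_int N\<close> by (simp add: le_floor_iff[symmetric])
    from abs_set_integral_floor_le[of t h, OF this] \<open>e > 0\<close> show ?thesis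
      by (simp add: dist_real_def)
  qed
  then show "\<forall>\<^sub>F t::real in at_top. dist (LINT s:{t..t+1}|lebesgue. h \<lfloor>s\<rfloor>) 0 < e"
    by (rule eventually_at_top_linorderI)
qed

lemma floor_in_BS:
  fixes h :: "int \<Rightarrow> 'a::real_normed_vector"
  assumes "p \<ge> 1" and "bounded (h ` {0..})"
  shows "(\<lambda>t. h \<lfloor>t\<rfloor>) \<in> BS p"
proof -
  from assms(2) obtain B where B: "\<And>n. n \<ge> 0 \<Longrightarrow> norm (h n) \<le> B"
    by (auto simp: bounded_iff)
  \<comment> \<open>From \<open>t \<ge> 0\<close> follows \<open>n \<ge> 0\<close>, where
    \<open>B\<close> applies; the resulting bound does not depend on \<open>t\<close>.\<close>
  have bound: "\<bar>norm (h n) powr p\<bar> \<le> B powr p" if "n \<ge> \<lfloor>t\<rfloor>" "t \<ge> 0" for n and t :: real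
    using B[of n] that \<open>p \<ge> 1\<close> by (auto intro!: powr_mono2 simp: order_trans[of 0 "\<lfloor>t\<rfloor>"])
  have "(LINT s:{t..t+1}|lebesgue. norm (h \<lfloor>s\<rfloor>) powr p) powr (1 / p) \<le> (B powr p) powr (1 / p)"
    if "t \<ge> 0" for t :: real
  proof (rule powr_mono2)
    show "0 \<le> (LINT s:{t..t+1}|lebesgue. norm (h \<lfloor>s\<rfloor>) powr p)"
      by (simp add: set_lebesgue_integral_def)
    show "(LINT s:{t..t+1}|lebesgue. norm (h \<lfloor>s\<rfloor>) powr p) \<le> B powr p"
      using abs_set_integral_floor_le[of t "\<lambda>n. norm (h n) powr p", OF bound[OF _ that]] by simp
  qed (use \<open>p \<ge> 1\<close> in simp)
  then have "bdd_above ((\<lambda>t::real. (LINT s:{t..t+1}|lebesgue. norm (h \<lfloor>s\<rfloor>) powr p) powr (1 / p)) ` {0..})"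
    by (intro bdd_aboveI2) auto
  then show ?thesis
    using set_integrable_floor[where h = "\<lambda>n. norm (h n) powr p", OF bound] by (auto simp: BS_def strongly_measurable_floor)
qed

text \<open>As \<open>\<omega>\<close> is an integer, \<open>\<lfloor>s + \<omega>\<rfloor> =
  \<lfloor>s\<rfloor> + \<omega>\<close>, so the Stepanov integrand is a function of
  \<open>\<lfloor>s\<rfloor>\<close> that tends to 0 along the integers.\<close>

lemma floor_in_Stepanov_SAP:
  fixes h :: "int \<Rightarrow> 'a::real_normed_vector" and \<omega> :: int
  assumes "p \<ge> 1" and "bounded (h ` {0..})"
    and "((\<lambda>n. h (n + \<omega>) - h n) \<longlongrightarrow> 0) at_top"
  shows "(\<lambda>t. h \<lfloor>t\<rfloor>) \<in> Stepanov_SAP p (of_int \<omega>)"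
proof -
  have "((\<lambda>n. norm (h (n + \<omega>) - h n) powr p) \<longlongrightarrow> 0 powr p) at_top"
    using tendsto_norm[OF assms(3)] \<open>p \<ge> 1\<close>
    \<comment> \<open>The base tends to 0, where continuity of the power relies on a positive
      exponent.\<close>
    by (intro tendsto_powr2) (auto intro: always_eventually)
  then have "((\<lambda>n. norm (h (n + \<omega>) - h n) powr p) \<longlongrightarrow> 0) at_top"
    using \<open>p \<ge> 1\<close> by simp
  from tendsto_set_integral_floor[OF this] show ?thesis
    using floor_in_BS[OF assms(1,2)] by (simp add: Stepanov_SAP_def)
qed

lemma continuous_on_floor_imp_constant:
  fixes h :: "int \<Rightarrow> 'a::t1_space"
  assumes cont: "continuous_on {0..} (\<lambda>t::real. h \<lfloor>t\<rfloor>)"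
  shows "h (int n) = h 0"
proof (induction n)
  case (Suc n)
  \<comment> \<open>The step function equals \<open>h (int n)\<close> on the half-open interval; by
    continuity this value persists at the added endpoint, where the floor is already
    \<open>n + 1\<close>.\<close>
  have cl: "closure {real n..<real n + 1} = {real n..real n + 1}"
    by (rule closure_atLeastLessThan) simp
  have "h \<lfloor>real n + 1\<rfloor> = h (int n)"
  proof (rule continuous_constant_on_closure[where f = "\<lambda>t. h \<lfloor>t\<rfloor>"])
    show "continuous_on (closure {real n..<real n + 1}) (\<lambda>t. h \<lfloor>t\<rfloor>)"
      unfolding cl by (rule continuous_on_subset[OF cont]) auto
    show "h \<lfloor>t\<rfloor> = h (int n)" if "t \<in> {real n..<real n + 1}" for t
      using that by (intro arg_cong[of _ _ h] floor_unique) auto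
  qed (simp add: cl)
  with Suc show ?case
    by (simp add: add.commute)
qed simp

theorem corollary2p5:
  fixes p :: real and \<omega> :: int and u :: "real \<Rightarrow> 'a::banach"
  assumes "p \<ge> 1" and "\<omega> \<ge> 1" and "u \<in> SAP (of_int \<omega>)"
  shows "(\<lambda>t. u (of_int \<lfloor>t\<rfloor>)) \<in> Stepanov_SAP p (of_int \<omega>) \<and>
    ((\<exists>m n :: nat. u (real m) \<noteq> u (real n)) \<longrightarrow>
      (\<lambda>t. u (of_int \<lfloor>t\<rfloor>)) \<notin> SAP (of_int \<omega>))"
proof (intro conjI impI notI)
  have "bounded (u ` {0..})" and lim: "((\<lambda>t. u (t + of_int \<omega>) - u t) \<longlongrightarrow> 0) at_top"
    using assms(3) by (auto simp: SAP_def)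
  then have bdd: "bounded ((\<lambda>n::int. u (of_int n)) ` {0..})"
    by (elim bounded_subset) auto
  \<comment> \<open>The limit over real \<open>t\<close> is restricted to integer arguments.\<close>
  have "((\<lambda>n::int. u (of_int (n + \<omega>)) - u (of_int n)) \<longlongrightarrow> 0) at_top"
    using filterlim_compose[OF lim filterlim_real_of_int_at_top] by simp
  from floor_in_Stepanov_SAP[OF assms(1) bdd this]
  show "(\<lambda>t. u (of_int \<lfloor>t\<rfloor>)) \<in> Stepanov_SAP p (of_int \<omega>)" .
next
  assume "(\<lambda>t. u (of_int \<lfloor>t\<rfloor>)) \<in> SAP (of_int \<omega>)"
  then have "continuous_on {0..} (\<lambda>t::real. u (of_int \<lfloor>t\<rfloor>))"
    by (simp add: SAP_def)
  from continuous_on_floor_imp_constant[OF this] have "u (real n) = u 0" for n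
    by simp
  moreover assume "\<exists>m n :: nat. u (real m) \<noteq> u (real n)"
  ultimately show False
    by simp
qed

end
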